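(* Let $\mathbf{s}=(s_1,\ldots,s_n)$ be a sequence of positive integers with $\gcd(s_i,s_{i+1})=1$ for $1\leq i<n$. Then $\mathcal{C}_n^{(\mathbf{s})}$ is Gorenstein if and only if $\mathbf{s}$ is $\mathbf{u}$-generated by some sequence $\mathbf{u}=(u_1,\ldots,u_{n-1})$ of positive integers. When such a sequence exists, the Gorenstein point $\mathbf{c}$ of $\mathcal{C}_n^{(\mathbf{s})}$ is given by $c_1=1$, $c_2=u_1$, and $c_{i+1}=u_ic_i-c_{i-1}$ for $2\leq i<n$.
   Context: $\mathcal{C}_n^{(\mathbf{s})}=\{\lambda\in\mathbb{R}^n: 0\leq\lambda_1/s_1\leq\cdots\leq\lambda_n/s_n\}$. A pointed rational cone $\mathcal{C}\subset\mathbb{R}^n$ is Gorenstein if there is an integer point $\mathbf{c}$ in the interior $\mathcal{C}^\circ$ such that $\mathcal{C}^\circ\cap\mathbb{Z}^n=\mathbf{c}+(\mathcal{C}\cap\mathbb{Z}^n)$; $\mathbf{c}$ is then called the Gorenstein point. A sequence $\mathbf{s}$ of positive integers is $\mathbf{u}$-generated by a sequence $\mathbf{u}$ of positive integers if $s_2=u_1s_1-1$ and $s_{i+1}=u_is_i-s_{i-1}$ for $i>1$. *)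

theory Defs
  imports "HOL-Analysis.Analysis"
begin

text \<open>
  The space \<open>\<real>^n\<close> is the library's \<^const>\<open>Euclidean_space\<close>: its points are the functions
  \<open>nat \<Rightarrow> real\<close> that vanish at all indices \<open>\<ge> n\<close>. Coordinates, and likewise the finite sequences
  \<open>s\<close>, \<open>u\<close> and \<open>c\<close>, are therefore numbered from 0: the entry \<open>s_i\<close> with \<open>1 \<le> i \<le> n\<close> is
  \<open>s (i - 1)\<close>. Values of \<open>s\<close> at indices \<open>\<ge> n\<close> and of \<open>u\<close> at indices \<open>\<ge> n - 1\<close> are irrelevant.
\<close>

definition integer_points :: "nat \<Rightarrow> (nat \<Rightarrow> real) set" where
  "integer_points n = {x \<in> topspace (Euclidean_space n). \<forall>i. x i \<in> \<int>}"

definition lecture_hall_cone :: "nat \<Rightarrow> (nat \<Rightarrow> int) \<Rightarrow> (nat \<Rightarrow> real) set" where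
  "lecture_hall_cone n s =
     {x \<in> topspace (Euclidean_space n).
        0 \<le> x 0 / real_of_int (s 0) \<and>
        (\<forall>i. i + 1 < n \<longrightarrow> x i / real_of_int (s i) \<le> x (i + 1) / real_of_int (s (i + 1)))}"

definition pointed_rational_cone :: "nat \<Rightarrow> (nat \<Rightarrow> real) set \<Rightarrow> bool" where
  "pointed_rational_cone n C \<longleftrightarrow>
     (\<exists>A :: (nat \<Rightarrow> rat) set. finite A \<and>
        C = {x \<in> topspace (Euclidean_space n). \<forall>a\<in>A. 0 \<le> (\<Sum>i<n. of_rat (a i) * x i)}) \<and>
     (\<forall>x\<in>C. (\<lambda>i. - x i) \<in> C \<longrightarrow> x = (\<lambda>i. 0))"

definition gorenstein_point :: "nat \<Rightarrow> (nat \<Rightarrow> real) set \<Rightarrow> (nat \<Rightarrow> real) \<Rightarrow> bool" where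
  "gorenstein_point n C c \<longleftrightarrow>
     c \<in> (Euclidean_space n interior_of C) \<inter> integer_points n \<and>
     (Euclidean_space n interior_of C) \<inter> integer_points n =
       (\<lambda>x i. c i + x i) ` (C \<inter> integer_points n)"

definition gorenstein_cone :: "nat \<Rightarrow> (nat \<Rightarrow> real) set \<Rightarrow> bool" where
  "gorenstein_cone n C \<longleftrightarrow> pointed_rational_cone n C \<and> (\<exists>c. gorenstein_point n C c)"

definition u_generated :: "nat \<Rightarrow> (nat \<Rightarrow> int) \<Rightarrow> (nat \<Rightarrow> int) \<Rightarrow> bool" where
  "u_generated n u s \<longleftrightarrow>
     (\<forall>i<n. 0 < s i) \<and> (\<forall>i. i + 1 < n \<longrightarrow> 0 < u i) \<and>
     (2 \<le> n \<longrightarrow> s 1 = u 0 * s 0 - 1) \<and>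
     (\<forall>i. 1 \<le> i \<and> i + 1 < n \<longrightarrow> s (i + 1) = u i * s i - s (i - 1))"

end

theory Submission
  imports Defs
begin

text \<open>
  The cone is cut out by the integral linear forms $L_0(x) = x_0$ and
  $L_i(x) = s_{i-1} x_i - s_i x_{i-1}$, and its interior by their strict positivity. Since
  consecutive entries of \<open>s\<close> are coprime, every $L_i$ takes the value 1 at some interior integer
  point, so the Gorenstein points are exactly the integer points with $L_i(c) = 1$ for all \<open>i\<close>.
  Subtracting consecutive equations gives $s_i (c_{i+1} + c_{i-1}) = c_i (s_{i+1} + s_{i-1})$ with
  $s_i$ and $c_i$ coprime; the common quotient of $s_{i+1} + s_{i-1}$ by $s_i$ and of
  $c_{i+1} + c_{i-1}$ by $c_i$ is $u_i$.
\<close>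

section \<open>Linear forms of the facets\<close>

definition facet_form :: "(nat \<Rightarrow> int) \<Rightarrow> nat \<Rightarrow> (nat \<Rightarrow> real) \<Rightarrow> real" where
  "facet_form s i x =
     (if i = 0 then x 0 else of_int (s (i - 1)) * x i - of_int (s i) * x (i - 1))"

lemma facet_form_0 [simp]: "facet_form s 0 x = x 0"
  by (simp add: facet_form_def)

lemma facet_form_Suc [simp]:
  "facet_form s (Suc i) x = of_int (s i) * x (Suc i) - of_int (s (Suc i)) * x i"
  by (simp add: facet_form_def)

lemma facet_form_add: "facet_form s i (\<lambda>j. x j + y j) = facet_form s i x + facet_form s i y"
  by (simp add: facet_form_def algebra_simps)

lemma facet_form_diff: "facet_form s i (\<lambda>j. x j - y j) = facet_form s i x - facet_form s i y"
  by (simp add: facet_form_def algebra_simps)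

lemma facet_form_uminus: "facet_form s i (\<lambda>j. - x j) = - facet_form s i x"
  by (simp add: facet_form_def)

lemma facet_form_scale: "facet_form s i (\<lambda>j. t * x j) = t * facet_form s i x"
  by (simp add: facet_form_def algebra_simps)

lemma facet_form_cong:
  assumes "\<And>j. j \<le> i \<Longrightarrow> x j = y j"
  shows "facet_form s i x = facet_form s i y"
  using assms by (simp add: facet_form_def)

text \<open>With denominators cleared the coefficients are integers; this is what later improves
  strict positivity at integer points to a value of at least 1.\<close>

lemma facet_form_Ints: "(\<And>j. x j \<in> \<int>) \<Longrightarrow> facet_form s i x \<in> \<int>"
  by (simp add: facet_form_def)

text \<open>In the coordinates \<open>x j / s j\<close> the forms measure increments, so test points
  with prescribed signs can be written down as \<open>s j\<close> times a simple sequence.\<close>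

lemma facet_form_times_s:
  "facet_form s i (\<lambda>j. of_int (s j) * x j) =
     (if i = 0 then of_int (s 0) * x 0
      else of_int (s (i - 1)) * of_int (s i) * (x i - x (i - 1)))"
  by (simp add: facet_form_def algebra_simps)

text \<open>The system is triangular with positive diagonal, so the coordinates are recovered one
  after another. This serves both pointedness and uniqueness of the Gorenstein point.\<close>

lemma facet_form_inj:
  assumes "\<forall>i<n. 0 < s i" and "\<And>i. i < n \<Longrightarrow> facet_form s i x = facet_form s i y"
  shows "i < n \<Longrightarrow> x i = y i"
proof (induction i)
  case 0
  then show ?case using assms(2)[of 0] by simp
next
  case (Suc i)
  with assms(2)[of "Suc i"] have "of_int (s i) * x (Suc i) = of_int (s i) * y (Suc i)"
    by simp
  moreover have "0 < s i" using Suc.prems assms(1) by simp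
  ultimately show ?case by simp
qed

section \<open>The cone and its interior as intersections of half-spaces\<close>

lemma mem_topspace_Euclidean_space: "x \<in> topspace (Euclidean_space n) \<longleftrightarrow> (\<forall>i\<ge>n. x i = 0)"
  by (simp add: topspace_Euclidean_space)

lemma lecture_hall_cone_eq:
  assumes "1 \<le> n" and s: "\<forall>i<n. 0 < s i"
  shows "lecture_hall_cone n s =
    {x \<in> topspace (Euclidean_space n). \<forall>i<n. 0 \<le> facet_form s i x}"
proof -
  have step: "x i / of_int (s i) \<le> x (i + 1) / of_int (s (i + 1)) \<longleftrightarrow> 0 \<le> facet_form s (Suc i) x"
    if "i + 1 < n" for x i
  proof -
    have "0 < s i" "0 < s (Suc i)" using s that by auto
    then show ?thesis by (simp add: divide_simps mult.commute)
  qed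
  have zero: "0 \<le> x 0 / of_int (s 0) \<longleftrightarrow> 0 \<le> facet_form s 0 x" for x :: "nat \<Rightarrow> real"
    using assms by (auto simp: zero_le_divide_iff)
  have all: "(\<forall>i<n. P i) \<longleftrightarrow> P 0 \<and> (\<forall>i. i + 1 < n \<longrightarrow> P (Suc i))" for P :: "nat \<Rightarrow> bool"
    using assms(1) by (metis Suc_eq_plus1 not0_implies_Suc less_le_trans zero_less_one)
  show ?thesis
    unfolding lecture_hall_cone_def all zero using step by auto
qed

text \<open>The strict inequalities define an open subset of the cone. Conversely, an interior point
  stays in the cone after a small move against a direction \<open>p\<close> on which all forms are
  positive, so its own forms are positive.\<close>

lemma interior_of_lecture_hall_cone:
  assumes "1 \<le> n" and s: "\<forall>i<n. 0 < s i"
  shows "Euclidean_space n interior_of lecture_hall_cone n s =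
    {x \<in> topspace (Euclidean_space n). \<forall>i<n. 0 < facet_form s i x}" (is "?I = ?S")
proof
  let ?X = "Euclidean_space n"
  have coord: "continuous_map ?X euclideanreal (\<lambda>x. x k)" for k
    unfolding Euclidean_space_def
    by (intro continuous_map_from_subtopology continuous_map_product_projection) simp
  have form: "continuous_map ?X euclideanreal (facet_form s i)" for i
    unfolding facet_form_def
    by (cases "i = 0") (auto intro!: coord continuous_map_diff continuous_map_real_mult)
  have "?S = (\<Inter>i<n. {x \<in> topspace ?X. facet_form s i x \<in> {0<..}}) \<inter> topspace ?X"
    by auto
  also have "openin ?X \<dots>"
    by (intro openin_INT openin_continuous_map_preimage[OF form]) auto
  finally have "openin ?X ?S" .
  then show "?S \<subseteq> ?I"
    by (rule interior_of_maximal[rotated]) (auto simp: lecture_hall_cone_eq[OF assms] less_imp_le)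
  show "?I \<subseteq> ?S"
  proof
    fix x assume x: "x \<in> ?I"
    \<comment> \<open>The ratios \<open>p j / s j\<close> are 1, 2, 3, ..., positive and strictly
      increasing; the cutoff at \<open>n\<close> keeps \<open>p\<close> in the space.\<close>
    define p :: "nat \<Rightarrow> real" where "p j = (if j < n then of_int (s j) * (of_nat j + 1) else 0)" for j
    have p: "0 < facet_form s i p" if "i < n" for i
    proof -
      have "facet_form s i p = facet_form s i (\<lambda>j. of_int (s j) * (of_nat j + 1))"
        using that by (intro facet_form_cong) (simp add: p_def)
      also have "\<dots> > 0"
        unfolding facet_form_times_s using s that by (auto simp: of_nat_diff)
      finally show ?thesis .
    qed
    have xX: "x \<in> topspace ?X"
      by (rule subsetD[OF interior_of_subset_topspace x])
    have cont: "continuous_map euclideanreal ?X (\<lambda>t j. x j - t * p j)"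
      using xX unfolding Euclidean_space_def mem_topspace_Euclidean_space
      by (auto simp: continuous_map_in_subtopology continuous_map_componentwise_UNIV p_def
          intro!: continuous_intros)
    have "open {t. (\<lambda>j. x j - t * p j) \<in> ?I}"
      using openin_continuous_map_preimage[OF cont openin_interior_of] by simp
    moreover have "0 \<in> {t. (\<lambda>j. x j - t * p j) \<in> ?I}"
      using x by simp
    \<comment> \<open>A closed ball is chosen so that \<open>t = e\<close> itself is
      admissible.\<close>
    ultimately obtain e where "e > 0" and e: "cball 0 e \<subseteq> {t. (\<lambda>j. x j - t * p j) \<in> ?I}"
      using open_contains_cball by blast
    then have "(\<lambda>j. x j - e * p j) \<in> ?I"
      by (auto simp: subset_iff dist_norm)
    then have "(\<lambda>j. x j - e * p j) \<in> lecture_hall_cone n s"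
      by (rule subsetD[OF interior_of_subset])
    then have "e * facet_form s i p \<le> facet_form s i x" if "i < n" for i
      using that unfolding lecture_hall_cone_eq[OF assms]
      by (auto simp: facet_form_diff facet_form_scale)
    with p \<open>e > 0\<close> xX show "x \<in> ?S"
      by (auto intro: less_le_trans[OF mult_pos_pos])
  qed
qed

section \<open>Pointedness and rationality\<close>

lemma pointed_rational_lecture_hall_cone:
  assumes "1 \<le> n" and s: "\<forall>i<n. 0 < s i"
  shows "pointed_rational_cone n (lecture_hall_cone n s)"
  unfolding pointed_rational_cone_def
proof (intro conjI exI ballI impI)
  \<comment> \<open>Two separate summands let \<open>sum.delta\<close> evaluate the form. For
    \<open>i = 0\<close> the truncated index \<open>i - 1\<close> is again 0, so the second
    coefficient is set to 0 there.\<close>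
  define row :: "nat \<Rightarrow> nat \<Rightarrow> rat" where "row i j =
    (if j = i then (if i = 0 then 1 else of_int (s (i - 1))) else 0) +
    (if j = i - 1 then (if i = 0 then 0 else - of_int (s i)) else 0)" for i j
  have "(\<Sum>j<n. of_rat (row i j) * x j) = facet_form s i x" if "i < n" for i and x :: "nat \<Rightarrow> real"
  proof -
    have "(\<Sum>j<n. of_rat (row i j) * x j) =
      (\<Sum>j<n. (if j = i then (if i = 0 then 1 else of_int (s (i - 1))) * x j else 0) +
               (if j = i - 1 then (if i = 0 then 0 else - of_int (s i)) * x j else 0))"
      by (intro sum.cong) (auto simp: row_def of_rat_add of_rat_minus algebra_simps)
    also have "\<dots> = facet_form s i x"
      using that by (simp add: sum.distrib sum.delta facet_form_def)
    finally show ?thesis .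
  qed
  then show "lecture_hall_cone n s = {x \<in> topspace (Euclidean_space n).
      \<forall>a\<in>row ` {..<n}. 0 \<le> (\<Sum>i<n. of_rat (a i) * x i)}"
    by (auto simp: lecture_hall_cone_eq[OF assms])
  show "finite (row ` {..<n})" by simp
next
  fix x assume x: "x \<in> lecture_hall_cone n s" "(\<lambda>i. - x i) \<in> lecture_hall_cone n s"
  \<comment> \<open>Each form is nonnegative at both \<open>x\<close> and its negative, hence
    vanishes at \<open>x\<close>.\<close>
  have "facet_form s i x = facet_form s i (\<lambda>i. 0)" if "i < n" for i
  proof -
    have "facet_form s i (\<lambda>i. 0) = 0" by (simp add: facet_form_def)
    with x that show ?thesis
      unfolding lecture_hall_cone_eq[OF assms] by (force simp: facet_form_uminus)
  qed
  from facet_form_inj[OF s this] x(1) show "x = (\<lambda>i. 0)"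
    unfolding lecture_hall_cone_eq[OF assms] mem_topspace_Euclidean_space
    by (auto simp: fun_eq_iff) (metis not_le)
qed

section \<open>Gorenstein points as integer solutions of L_i = 1\<close>

text \<open>
  A lattice point with $L_k = 1$ is moved into the interior by adding a large multiple of a
  lattice point on the facet $L_k = 0$ at which all other forms are positive.
\<close>
lemma interior_integer_point_on_level_1:
  assumes s: "\<forall>i<n. 0 < s i"
    and cop: "\<forall>i. i + 1 < n \<longrightarrow> gcd (s i) (s (i + 1)) = 1"
    and k: "k < n"
  obtains x where "x \<in> integer_points n" "\<forall>i<n. 0 < facet_form s i x" "facet_form s k x = 1"
proof -
  \<comment> \<open>For \<open>k > 0\<close> the Bezout coefficients of \<open>s (k - 1)\<close> and
    \<open>s k\<close> give the coordinates, the second with its sign flipped; this is where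
    coprimality enters.\<close>
  obtain v :: "nat \<Rightarrow> int" where v: "facet_form s k (\<lambda>j. of_int (v j)) = 1"
  proof (cases k)
    case 0
    then show ?thesis by (intro that[of "\<lambda>_. 1"]) simp
  next
    case (Suc m)
    then have "gcd (s m) (s (Suc m)) = 1" using cop k by simp
    then obtain a b where ab: "a * s m + b * s (Suc m) = 1"
      by (metis bezout_int)
    have "facet_form s k (\<lambda>j. of_int (if j = k then a else - b)) = of_int (a * s m + b * s (Suc m))"
      using Suc by (simp add: algebra_simps)
    with ab show ?thesis by (intro that[of "\<lambda>j. if j = k then a else - b"]) simp
  qed
  \<comment> \<open>The ratios \<open>w j / s j\<close> increase by 1 at each step except from
    \<open>k - 1\<close> to \<open>k\<close>, where they agree; for \<open>k = 0\<close> they start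
    at 0 instead of 1.\<close>
  define w :: "nat \<Rightarrow> real" where "w j = of_int (s j) * (if j < k then of_nat j + 1 else of_nat j)" for j
  have w_k: "facet_form s k w = 0"
    unfolding w_def facet_form_times_s by (auto simp: of_nat_diff)
  have w_ge: "1 \<le> facet_form s i w" if "i < n" "i \<noteq> k" for i
  proof -
    have "0 < facet_form s i w"
      unfolding w_def facet_form_times_s using s that by (auto simp: of_nat_diff)
    moreover have "facet_form s i w \<in> \<int>"
      by (rule facet_form_Ints) (simp add: w_def)
    ultimately show ?thesis using Ints_nonzero_abs_ge1 by fastforce
  qed
  \<comment> \<open>The sum dominates every single absolute value, and the floors are exact because
    the forms take integer values at \<open>v\<close>; the extra 1 makes the bound strict.\<close>
  define M :: int where "M = 1 + (\<Sum>i<n. \<bar>\<lfloor>facet_form s i (\<lambda>j. of_int (v j))\<rfloor>\<bar>)"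
  have M: "- facet_form s i (\<lambda>j. of_int (v j)) < of_int M" if "i < n" for i
  proof -
    have "facet_form s i (\<lambda>j. of_int (v j)) \<in> \<int>"
      by (rule facet_form_Ints) simp
    then have "- facet_form s i (\<lambda>j. of_int (v j)) \<le> of_int \<bar>\<lfloor>facet_form s i (\<lambda>j. of_int (v j))\<rfloor>\<bar>"
      by (auto elim!: Ints_cases)
    moreover have "\<bar>\<lfloor>facet_form s i (\<lambda>j. of_int (v j))\<rfloor>\<bar> < M"
      using member_le_sum[of i "{..<n}" "\<lambda>i. \<bar>\<lfloor>facet_form s i (\<lambda>j. of_int (v j))\<rfloor>\<bar>"] that
      by (simp add: M_def)
    ultimately show ?thesis by linarith
  qed
  have "1 \<le> M" by (simp add: M_def sum_nonneg)
  define x :: "nat \<Rightarrow> real" where "x j = (if j < n then of_int (v j) + of_int M * w j else 0)" for j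
  have x: "facet_form s i x = facet_form s i (\<lambda>j. of_int (v j)) + of_int M * facet_form s i w"
    if "i < n" for i
  proof -
    have "facet_form s i x = facet_form s i (\<lambda>j. of_int (v j) + of_int M * w j)"
      using that by (intro facet_form_cong) (simp add: x_def)
    then show ?thesis by (simp only: facet_form_add facet_form_scale)
  qed
  have "0 < facet_form s i x" if "i < n" for i
  proof (cases "i = k")
    case True
    then show ?thesis using x[OF that] v w_k by simp
  next
    case False
    have "of_int M * 1 \<le> of_int M * facet_form s i w"
      using w_ge[OF that False] \<open>1 \<le> M\<close> by (intro mult_left_mono) auto
    then show ?thesis using x[OF that] M[OF that] by linarith
  qed
  moreover have "x \<in> integer_points n"
    by (auto simp: integer_points_def mem_topspace_Euclidean_space x_def w_def)
  ultimately show ?thesis using that x[OF k] v w_k by simp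
qed

text \<open>Translating the cone by \<open>c\<close> gives L_k at least L_k(c), so an interior
  integer point with L_k = 1 forces L_k(c) = 1. Conversely, L_i is at least 1 = L_i(c) at interior
  integer points, so subtracting \<open>c\<close> lands in the cone.\<close>

lemma gorenstein_point_lecture_hall_cone_iff:
  assumes n: "1 \<le> n" and s: "\<forall>i<n. 0 < s i"
    and cop: "\<forall>i. i + 1 < n \<longrightarrow> gcd (s i) (s (i + 1)) = 1"
  shows "gorenstein_point n (lecture_hall_cone n s) c \<longleftrightarrow>
    c \<in> integer_points n \<and> (\<forall>i<n. facet_form s i c = 1)"
proof -
  let ?C = "{x \<in> integer_points n. \<forall>i<n. 0 \<le> facet_form s i x}"
  let ?I = "{x \<in> integer_points n. \<forall>i<n. 0 < facet_form s i x}"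
  have C: "lecture_hall_cone n s \<inter> integer_points n = ?C"
    unfolding lecture_hall_cone_eq[OF n s] by (auto simp: integer_points_def)
  have I: "(Euclidean_space n interior_of lecture_hall_cone n s) \<inter> integer_points n = ?I"
    unfolding interior_of_lecture_hall_cone[OF n s] by (auto simp: integer_points_def)
  have ge1: "1 \<le> facet_form s i x" if "x \<in> ?I" "i < n" for i x
  proof -
    have "facet_form s i x \<in> \<int>"
      using that by (intro facet_form_Ints) (auto simp: integer_points_def)
    then show ?thesis using that Ints_nonzero_abs_ge1 by fastforce
  qed
  show ?thesis unfolding gorenstein_point_def C I
  proof (intro iffI conjI allI impI)
    assume c: "c \<in> ?I \<and> ?I = (\<lambda>x i. c i + x i) ` ?C"
    then show "c \<in> integer_points n" by simp
    fix k assume k: "k < n"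
    obtain x where "x \<in> ?I" and x1: "facet_form s k x = 1"
      using interior_integer_point_on_level_1[OF s cop k] by auto
    then have "x \<in> (\<lambda>x i. c i + x i) ` ?C" using c by simp
    then obtain y where "y \<in> ?C" "x = (\<lambda>i. c i + y i)" by blast
    then have "facet_form s k c \<le> 1"
      using k x1 by (auto simp: facet_form_add)
    with ge1[of c k] c k show "facet_form s k c = 1" by auto
  next
    assume c: "c \<in> integer_points n \<and> (\<forall>i<n. facet_form s i c = 1)"
    then show "c \<in> ?I" by simp
    show "?I = (\<lambda>x i. c i + x i) ` ?C"
    proof (intro equalityI subsetI)
      fix x assume x: "x \<in> ?I"
      have "(\<lambda>i. x i - c i) \<in> ?C"
        using x c ge1[OF x]
        by (auto simp: facet_form_diff integer_points_def mem_topspace_Euclidean_space)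
      then show "x \<in> (\<lambda>x i. c i + x i) ` ?C"
        by (rule rev_image_eqI) simp
    next
      fix x assume "x \<in> (\<lambda>x i. c i + x i) ` ?C"
      then show "x \<in> ?I"
        using c by (force simp: facet_form_add integer_points_def mem_topspace_Euclidean_space
            intro: add_pos_nonneg)
    qed
  qed
qed

section \<open>Three-term recurrences and \<open>u\<close>-generation\<close>

fun u_recurrence :: "(nat \<Rightarrow> int) \<Rightarrow> nat \<Rightarrow> int" where
  "u_recurrence u 0 = 1"
| "u_recurrence u (Suc 0) = u 0"
| "u_recurrence u (Suc (Suc i)) = u (Suc i) * u_recurrence u (Suc i) - u_recurrence u i"

text \<open>Both sequences solve y_(i+1) = u_i y_i - y_(i-1), with virtual values 1 for
  \<open>s\<close> and 0 for \<open>u_recurrence u\<close> at index -1. Their Casoratian is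
  therefore constant, and it starts at 1.\<close>

lemma u_generated_recurrence:
  assumes "u_generated n u s"
  shows "Suc i < n \<Longrightarrow> s i * u_recurrence u (Suc i) - s (Suc i) * u_recurrence u i = 1"
proof (induction i)
  case 0
  then show ?case using assms by (simp add: u_generated_def mult.commute)
next
  case (Suc i)
  then have "s i * u_recurrence u (Suc i) - s (Suc i) * u_recurrence u i = 1" by simp
  moreover have s: "s (Suc (Suc i)) = u (Suc i) * s (Suc i) - s i"
    using assms Suc.prems unfolding u_generated_def
    by (metis Suc_eq_plus1 diff_Suc_1 le_add2)
  have "s (Suc i) * u_recurrence u (Suc (Suc i)) - s (Suc (Suc i)) * u_recurrence u (Suc i)
      = s i * u_recurrence u (Suc i) - s (Suc i) * u_recurrence u i"
    unfolding s by (simp add: algebra_simps)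
  ultimately show ?case by simp
qed

lemma facet_form_1_imp_u_generated:
  assumes n: "1 \<le> n" and s: "\<forall>i<n. 0 < s i"
    and c: "c \<in> integer_points n" "\<forall>i<n. facet_form s i c = 1"
  shows "\<exists>u. u_generated n u s"
proof -
  have "\<forall>j. \<exists>d. c j = of_int d"
    using c(1) by (auto simp: integer_points_def elim: Ints_cases)
  then obtain d :: "nat \<Rightarrow> int" where "\<forall>j. c j = of_int (d j)"
    by metis
  then have cd: "c = (\<lambda>j. of_int (d j))" by auto
  have d0: "d 0 = 1"
    using c(2) n by (auto simp: cd)
  have d: "s i * d (Suc i) - s (Suc i) * d i = 1" if "Suc i < n" for i
  proof -
    have "real_of_int (s i * d (Suc i) - s (Suc i) * d i) = 1"
      using c(2) that by (auto simp: cd)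
    then show ?thesis by linarith
  qed
  \<comment> \<open>\<open>r i\<close> is the value required of \<open>u i * s i\<close>; the 1 at
    \<open>i = 0\<close> plays the part of a preceding entry of \<open>s\<close>.\<close>
  define r where "r i = s (Suc i) + (if i = 0 then 1 else s (i - 1))" for i
  define u where "u i = r i div s i" for i
  have u: "u i * s i = r i \<and> 0 < u i" if "i + 1 < n" for i
  proof -
    have "s i dvd r i"
    proof (cases i)
      case 0
      \<comment> \<open>As \<open>d 0 = 1\<close>, the first equation reads
        \<open>s 1 + 1 = s 0 * d 1\<close>.\<close>
      then show ?thesis
        using d[of 0] d0 that by (auto simp: r_def intro!: dvdI[of _ _ "d 1"])
    next
      case (Suc m)
      have "s m * d i - s i * d m = 1" "s i * d (Suc i) - s (Suc i) * d i = 1"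
        using d[of m] d[of i] that Suc by auto
      then have "d i * r i = s i * (d (Suc i) + d m)"
        using Suc by (simp add: r_def algebra_simps)
      then have "s i dvd d i * r i" by simp
      \<comment> \<open>A common divisor divides the left side of the preceding equation, which
        equals 1.\<close>
      moreover have "coprime (s i) (d i)"
      proof (rule coprimeI)
        fix e assume "e dvd s i" "e dvd d i"
        then have "e dvd s m * d i - s i * d m" by simp
        with \<open>s m * d i - s i * d m = 1\<close> show "is_unit e" by simp
      qed
      ultimately show ?thesis
        by (simp add: coprime_dvd_mult_right_iff)
    qed
    then have "u i * s i = r i" by (simp add: u_def)
    moreover have "0 < r i" "0 < s i"
      using s that by (auto simp: r_def add_pos_pos)
    ultimately show ?thesis by (metis zero_less_mult_pos2)
  qed
  have "u_generated n u s"
    unfolding u_generated_def using s u by (auto simp: r_def)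
  then show ?thesis by blast
qed

section \<open>The equivalence and the coordinates of the Gorenstein point\<close>

theorem theorem2p8:
  fixes n :: nat and s :: "nat \<Rightarrow> int"
  assumes "1 \<le> n"
    and "\<forall>i<n. 0 < s i"
    and "\<forall>i. i + 1 < n \<longrightarrow> gcd (s i) (s (i + 1)) = 1"
  shows "(gorenstein_cone n (lecture_hall_cone n s) \<longleftrightarrow> (\<exists>u. u_generated n u s)) \<and>
    (\<forall>u. u_generated n u s \<longrightarrow>
       (\<exists>!c. gorenstein_point n (lecture_hall_cone n s) c) \<and>
       (\<forall>c. gorenstein_point n (lecture_hall_cone n s) c \<longrightarrow>
          c 0 = 1 \<and>
          (2 \<le> n \<longrightarrow> c 1 = real_of_int (u 0)) \<and>
          (\<forall>i. 1 \<le> i \<and> i + 1 < n \<longrightarrow> c (i + 1) = real_of_int (u i) * c i - c (i - 1))))"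
proof -
  note iff = gorenstein_point_lecture_hall_cone_iff[OF assms]
  \<comment> \<open>The recurrence solution, cut off at \<open>n\<close> to lie in the
    space.\<close>
  define g :: "(nat \<Rightarrow> int) \<Rightarrow> nat \<Rightarrow> real" where
    "g u j = (if j < n then of_int (u_recurrence u j) else 0)" for u j
  have g: "gorenstein_point n (lecture_hall_cone n s) (g u)" if u: "u_generated n u s" for u
  proof -
    have "facet_form s i (g u) = 1" if "i < n" for i
    proof (cases i)
      case 0
      then show ?thesis using assms(1) by (simp add: g_def)
    next
      case (Suc m)
      have "real_of_int (s m * u_recurrence u (Suc m) - s (Suc m) * u_recurrence u m) = 1"
        using u_generated_recurrence[OF u, of m] that Suc by simp
      with that Suc show ?thesis by (simp add: g_def)
    qed
    moreover have "g u \<in> integer_points n"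
      by (auto simp: g_def integer_points_def mem_topspace_Euclidean_space)
    ultimately show ?thesis by (simp add: iff)
  qed
  have uniq: "c = g u"
    if u: "u_generated n u s" and c: "gorenstein_point n (lecture_hall_cone n s) c" for u c
  proof
    fix i
    show "c i = g u i"
    proof (cases "i < n")
      case True
      then show ?thesis
        using facet_form_inj[OF assms(2), of c "g u" i] c g[OF u] by (auto simp: iff)
    next
      case False
      then show ?thesis
        using c by (auto simp: iff g_def integer_points_def mem_topspace_Euclidean_space)
    qed
  qed
  have cone: "gorenstein_cone n (lecture_hall_cone n s) \<longleftrightarrow> (\<exists>u. u_generated n u s)"
  proof
    assume "gorenstein_cone n (lecture_hall_cone n s)"
    then obtain c where "gorenstein_point n (lecture_hall_cone n s) c"
      unfolding gorenstein_cone_def by blast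
    then show "\<exists>u. u_generated n u s"
      using facet_form_1_imp_u_generated[OF assms(1,2), of c] by (simp add: iff)
  next
    assume "\<exists>u. u_generated n u s"
    then show "gorenstein_cone n (lecture_hall_cone n s)"
      using g pointed_rational_lecture_hall_cone[OF assms(1,2)]
      unfolding gorenstein_cone_def by blast
  qed
  \<comment> \<open>By \<open>uniq\<close>, formulas for \<open>g u\<close> carry over to every
    Gorenstein point; \<open>i + 1 < n\<close> keeps all three indices below the cutoff.\<close>
  have "g u (i + 1) = real_of_int (u i) * g u i - g u (i - 1)" if "1 \<le> i" "i + 1 < n" for u i
    using that by (cases i) (auto simp: g_def)
  moreover have "g u 0 = 1" "2 \<le> n \<longrightarrow> g u 1 = real_of_int (u 0)" for u
    using assms(1) by (auto simp: g_def)
  ultimately have rec: "g u 0 = 1 \<and> (2 \<le> n \<longrightarrow> g u 1 = real_of_int (u 0)) \<and>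
      (\<forall>i. 1 \<le> i \<and> i + 1 < n \<longrightarrow> g u (i + 1) = real_of_int (u i) * g u i - g u (i - 1))" for u
    by blast
  show ?thesis
  proof (intro conjI[OF cone] allI impI)
    fix u assume u: "u_generated n u s"
    show "(\<exists>!c. gorenstein_point n (lecture_hall_cone n s) c) \<and>
       (\<forall>c. gorenstein_point n (lecture_hall_cone n s) c \<longrightarrow>
          c 0 = 1 \<and>
          (2 \<le> n \<longrightarrow> c 1 = real_of_int (u 0)) \<and>
          (\<forall>i. 1 \<le> i \<and> i + 1 < n \<longrightarrow> c (i + 1) = real_of_int (u i) * c i - c (i - 1)))"
      using g[OF u] uniq[OF u] rec[of u] by blast
  qed
qed

end
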